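(* Fix $r\ge1$ and let $\varepsilon_r=\left(2^{r-m}\,2r\ln m\right)^{1/2^{r+1}}$. For $\mathrm{RM}(r,m)$ used on a binary symmetric channel with crossover probability $(1-\varepsilon_r)/2$, the algorithm $\Psi_r^m$ has, as $m\to\infty$, $$\max_{\xi\in\Gamma}p(\xi)\le(1+o(1))\,\frac{m^{-r}}{\sqrt{4\pi r\ln m}},$$ with asymptotic equality $p(\xi_* )=(1+o(1))\,m^{-r}/\sqrt{4\pi r\ln m}$ on the path $\xi_*=(0^r,1^{m-r})$.
   Context: Assume the all-ones codeword (in $\pm1$ form) is sent; received $y_1,\dots,y_n$ ($n=2^m$) are i.i.d. with $\Pr\{y_i=-1\}=(1-\varepsilon_r)/2$, $\Pr\{y_i=1\}=(1+\varepsilon_r)/2$. For binary strings $\xi$ define $\mathbf y(\varnothing)=\mathbf y$ and, splitting $\mathbf y(\underline\xi)=(\mathbf y'(\underline\xi),\mathbf y''(\underline\xi))$ into halves, $\mathbf y(\underline\xi,0)=\mathbf y'(\underline\xi)\mathbf y''(\underline\xi)$ (componentwise), $\mathbf y(\underline\xi,1)=(\mathbf y'(\underline\xi)+\mathbf y''(\underline\xi))/2$; these are the inputs of the recursive decoder $\Psi_r^m$ (which on $(\mathbf y',\mathbf y'')$ decodes $\mathbf y'\mathbf y''$ in $\mathrm{RM}(r-1,m-1)$ to get $\hat{\mathbf v}$, then $(\mathbf y'+\mathbf y''\hat{\mathbf v})/2$ in $\mathrm{RM}(r,m-1)$, with MD decoding at $r=0$ or $r=m$) when all previous decisions are correct.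 Paths: from node $(m,r)$ a step $0$ goes to $(m'-1,r'-1)$, a step $1$ to $(m'-1,r')$, stopping at $(g,0)$ or $(h,h)$ ($g,h\ge1$); $\Gamma$ is the set of information paths: left-end paths (end subpath to $(g,0)$ followed by $1^g$) and right-end paths (end subpath $\underline\xi$ to $(h,h)$ followed by any $h$-bit string $\sigma$); equivalently, binary strings of length $m$ and weight $\ge m-r$. The decision statistic $y(\xi)$ is the single entry of $\mathbf y(\xi)$ for a left-end path (the average of the entries of the vector at the repetition node), and the entry of $\mathbf y(\underline\xi)$ indexed by $\sigma$ for a right-end path. $p(\xi)=\Pr\{y(\xi)<0\}+\tfrac12\Pr\{y(\xi)=0\}$ is the bit error probability at $\xi$ given that all previous decodings were correct. *)

theory Defs
  imports "HOL-Analysis.Analysis" "HOL-Library.Landau_Symbols"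
begin

text \<open>Received vectors are real lists of length 2^m. A path is a bool list:
  False = step 0 (to (m'-1,r'-1)), True = step 1 (to (m'-1,r')).\<close>

definition half_prod :: "real list \<Rightarrow> real list" where
  "half_prod v = map2 (*) (take (length v div 2) v) (drop (length v div 2) v)"

definition half_avg :: "real list \<Rightarrow> real list" where
  "half_avg v = map2 (\<lambda>a b. (a + b) / 2) (take (length v div 2) v) (drop (length v div 2) v)"

definition bits_to_nat :: "bool list \<Rightarrow> nat" where
  "bits_to_nat bs = foldl (\<lambda>acc b. 2 * acc + (if b then 1 else 0)) 0 bs"

text \<open>Decision statistic y(xi): current node (length of remaining path, r'),
  current vector v. At a node (g,0) the statistic is the average of the entries
  (repetition code); at a node (h,h) it is the entry indexed by the remaining
  h bits sigma.\<close>
fun stat :: "nat \<Rightarrow> bool list \<Rightarrow> real list \<Rightarrow> real" where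
  "stat r [] v = hd v"
| "stat r (b # bs) v =
     (if r = 0 then sum_list v / real (length v)
      else if r = length (b # bs) then v ! bits_to_nat (b # bs)
      else if b then stat r bs (half_avg v)
      else stat (r - 1) bs (half_prod v))"

definition Gamma :: "nat \<Rightarrow> nat \<Rightarrow> bool list set" where
  "Gamma r m = {xs. length xs = m \<and> m - r \<le> length (filter id xs)}"

text \<open>Channel output: y_i = 1 w.p. (1+eps)/2, y_i = -1 w.p. (1-eps)/2, i.i.d.
  A sign pattern is a bool list s (True = +1).\<close>
definition sign_weight :: "real \<Rightarrow> bool list \<Rightarrow> real" where
  "sign_weight eps s = (\<Prod>b\<leftarrow>s. if b then (1 + eps) / 2 else (1 - eps) / 2)"

definition to_pm :: "bool list \<Rightarrow> real list" where
  "to_pm s = map (\<lambda>b. if b then 1 else -1) s"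

definition perr :: "nat \<Rightarrow> nat \<Rightarrow> real \<Rightarrow> bool list \<Rightarrow> real" where
  "perr r m eps xi =
     (\<Sum>s\<in>{s. length s = 2 ^ m}.
        sign_weight eps s *
        (let t = stat r xi (to_pm s) in
           if t < 0 then 1 else if t = 0 then 1 / 2 else 0))"

definition eps_r :: "nat \<Rightarrow> nat \<Rightarrow> real" where
  "eps_r r m = (2 powr (real r - real m) * (2 * real r * ln (real m))) powr (1 / 2 ^ (r + 1))"

definition bound_r :: "nat \<Rightarrow> nat \<Rightarrow> real" where
  "bound_r r m = (real m powr (- real r)) / sqrt (4 * pi * real r * ln (real m))"

definition xi_star :: "nat \<Rightarrow> nat \<Rightarrow> bool list" where
  "xi_star r m = replicate r False @ replicate (m - r) True"

end

theory Submission
  imports Defs "HOL-Probability.Probability" "HOL-Real_Asymp.Real_Asymp"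
begin

text \<open>The statistic of a path is obtained from i.i.d. signs of mean \<open>\<epsilon>\<close> by repeatedly multiplying or
  averaging two independent copies, with exactly \<open>m - r\<close> averagings and at most \<open>r\<close> products.
  Replacing an averaging followed by a product by a product followed by an averaging increases the
  law in the convex order, hence increases every Chernoff bound. A path other than \<open>\<xi>\<^sub>*\<close> with \<open>r\<close> products
  is therefore dominated by \<open>(0\<^sup>r\<^sup>-\<^sup>1, 1, 0, 1\<^sup>m\<^sup>-\<^sup>r\<^sup>-\<^sup>1)\<close>, whose variance is about half that of \<open>\<xi>\<^sub>*\<close>; this doubles
  the exponent of the Chernoff bound. Paths with fewer products keep a much larger mean and are dominated
  by a repetition code. On \<open>\<xi>\<^sub>*\<close> the statistic is the average of \<open>2 M = 2\<^sup>m\<^sup>-\<^sup>r\<close> signs of mean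
  \<open>\<delta> = \<epsilon> ^ (2 ^ r)\<close> with \<open>M \<delta>\<^sup>2 = r ln m\<close>, and its error probability is a binomial tail asymptotic to
  \<open>(1 - \<delta>\<^sup>2)\<^sup>M / (2 \<delta> sqrt (\<pi> M))\<close>.\<close>

section \<open>The law of the decision statistic\<close>

definition combine :: "bool \<Rightarrow> real \<Rightarrow> real \<Rightarrow> real" where
  "combine b x y = (if b then (x + y) / 2 else x * y)"

text \<open>Law of one entry after a decoding step; the two copies are independent because they come
  from different halves of the vector.\<close>

definition step :: "bool \<Rightarrow> real pmf \<Rightarrow> real pmf" where
  "step b p = do {x \<leftarrow> p; y \<leftarrow> p; return_pmf (combine b x y)}"

text \<open>Processing order: the head of the word acts first, on the channel symbols themselves.\<close>

fun law :: "bool list \<Rightarrow> real pmf \<Rightarrow> real pmf" where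
  "law [] p = p"
| "law (b # bs) p = law bs (step b p)"

lemma law_append: "law (u @ v) p = law v (law u p)"
  by (induction u arbitrary: p) auto

section \<open>Vectors with independent entries under halving\<close>

lemma replicate_pmf_map2:
  "do {u \<leftarrow> replicate_pmf n p; v \<leftarrow> replicate_pmf n q; return_pmf (map2 f u v)} =
   replicate_pmf n (do {x \<leftarrow> p; y \<leftarrow> q; return_pmf (f x y)})"
proof (induction n)
  case (Suc n)
  have "do {u \<leftarrow> replicate_pmf (Suc n) p; v \<leftarrow> replicate_pmf (Suc n) q; return_pmf (map2 f u v)} =
     do {x \<leftarrow> p; u \<leftarrow> replicate_pmf n p; y \<leftarrow> q; v \<leftarrow> replicate_pmf n q; return_pmf (f x y # map2 f u v)}"
    by (simp add: bind_assoc_pmf bind_return_pmf)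
  also have "\<dots> = do {x \<leftarrow> p; y \<leftarrow> q; u \<leftarrow> replicate_pmf n p; v \<leftarrow> replicate_pmf n q; return_pmf (f x y # map2 f u v)}"
    by (intro bind_pmf_cong refl bind_commute_pmf)
  also have "\<dots> = do {x \<leftarrow> p; y \<leftarrow> q;
      w \<leftarrow> do {u \<leftarrow> replicate_pmf n p; v \<leftarrow> replicate_pmf n q; return_pmf (map2 f u v)};
      return_pmf (f x y # w)}"
    by (simp add: bind_assoc_pmf bind_return_pmf)
  also have "\<dots> = replicate_pmf (Suc n) (do {x \<leftarrow> p; y \<leftarrow> q; return_pmf (f x y)})"
    unfolding Suc.IH by (simp add: bind_assoc_pmf bind_return_pmf)
  finally show ?case .
qed (simp add: bind_return_pmf)

text \<open>The halves of an i.i.d. vector are independent, and pairing them coordinatewise gives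
  i.i.d. entries again. The decoder input at a node is therefore described by the law of a single
  entry.\<close>

lemma map_pmf_halves:
  assumes "\<And>v. h v = map2 (combine b) (take (length v div 2) v) (drop (length v div 2) v)"
  shows "map_pmf h (replicate_pmf (2 * n) p) = replicate_pmf n (step b p)"
proof -
  have "map_pmf h (replicate_pmf (2 * n) p) =
      do {u \<leftarrow> replicate_pmf n p; v \<leftarrow> replicate_pmf n p; return_pmf (h (u @ v))}"
    by (simp add: mult_2 replicate_pmf_distrib map_bind_pmf)
  also have "\<dots> = do {u \<leftarrow> replicate_pmf n p; v \<leftarrow> replicate_pmf n p; return_pmf (map2 (combine b) u v)}"
    by (intro bind_pmf_cong refl) (auto simp: set_replicate_pmf assms)
  also have "\<dots> = replicate_pmf n (step b p)"
    unfolding step_def by (rule replicate_pmf_map2)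
  finally show ?thesis .
qed

lemma half_prod_replicate:
  "map_pmf half_prod (replicate_pmf (2 * n) p) = replicate_pmf n (step False p)"
  by (rule map_pmf_halves) (simp add: half_prod_def combine_def[abs_def])

lemma half_avg_replicate:
  "map_pmf half_avg (replicate_pmf (2 * n) p) = replicate_pmf n (step True p)"
  by (rule map_pmf_halves) (simp add: half_avg_def combine_def[abs_def])

lemma sum_list_map2_avg:
  "length u = length v \<Longrightarrow>
   sum_list (map2 (\<lambda>a b. (a + b) / 2) u v) = (sum_list u + sum_list v) / (2::real)"
  by (induction u v rule: list_induct2) (auto simp: field_simps)

lemma sum_list_half_avg:
  assumes "even (length v)"
  shows "sum_list (half_avg v) = sum_list v / 2"
proof -
  have "sum_list (half_avg v) = (sum_list (take (length v div 2) v) + sum_list (drop (length v div 2) v)) / 2"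
    unfolding half_avg_def by (rule sum_list_map2_avg) (use assms in auto)
  also have "\<dots> = sum_list v / 2"
    by (metis append_take_drop_id sum_list_append)
  finally show ?thesis .
qed

text \<open>Halving by averages preserves the mean of the entries. This lets a repetition node be
  read as a run of \<open>True\<close> steps.\<close>

lemma law_replicate_True:
  "law (replicate g True) p = map_pmf (\<lambda>v. sum_list v / 2 ^ g) (replicate_pmf (2 ^ g) p)"
proof (induction g arbitrary: p)
  case 0
  show ?case by (simp add: replicate_pmf_1[simplified] pmf.map_comp o_def)
next
  case (Suc g)
  have "law (replicate (Suc g) True) p =
      map_pmf (\<lambda>v. sum_list v / 2 ^ g) (map_pmf half_avg (replicate_pmf (2 * 2 ^ g) p))"
    by (simp only: half_avg_replicate replicate_Suc law.simps Suc.IH)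
  also have "\<dots> = map_pmf (\<lambda>v. sum_list (half_avg v) / 2 ^ g) (replicate_pmf (2 * 2 ^ g) p)"
    by (simp add: pmf.map_comp o_def)
  also have "\<dots> = map_pmf (\<lambda>v. sum_list v / 2 ^ Suc g) (replicate_pmf (2 * 2 ^ g) p)"
    by (intro map_pmf_cong refl)
       (auto simp: set_replicate_pmf sum_list_half_avg field_simps)
  finally show ?case by simp
qed

lemma map_nth_replicate_pmf:
  "i < n \<Longrightarrow> map_pmf (\<lambda>v. v ! i) (replicate_pmf n p) = p"
proof (induction n arbitrary: i)
  case (Suc n)
  show ?case
  proof (cases i)
    case 0
    then show ?thesis by (simp add: map_bind_pmf bind_return_pmf')
  next
    case (Suc j)
    then have "map_pmf (\<lambda>v. v ! j) (replicate_pmf n p) = p"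
      using Suc.IH Suc.prems by auto
    then have "replicate_pmf n p \<bind> (\<lambda>xs. return_pmf (xs ! j)) = p"
      by (simp add: map_pmf_def)
    then show ?thesis using Suc by (simp add: map_bind_pmf)
  qed
qed auto

lemma foldl_bits_less:
  "foldl (\<lambda>acc b. 2 * acc + (if b then 1 else 0)) a bs < (a + 1) * 2 ^ length bs" for a :: nat
proof (induction bs arbitrary: a)
  case (Cons b bs)
  let ?c = "2 * a + (if b then 1 else 0)"
  have "foldl (\<lambda>acc b. 2 * acc + (if b then 1 else 0)) ?c bs < (?c + 1) * 2 ^ length bs"
    by (rule Cons.IH)
  also have "\<dots> \<le> (2 * (a + 1)) * 2 ^ length bs"
    by (intro mult_right_mono) auto
  finally show ?case by (simp add: algebra_simps)
qed auto

lemma bits_to_nat_less: "bits_to_nat bs < 2 ^ length bs"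
  using foldl_bits_less[of 0 bs] by (simp add: bits_to_nat_def)

section \<open>The word of operations attached to a path\<close>

lemma count_list_replicate: "count_list (replicate n x) y = (if x = y then n else 0)"
  by (induction n) auto

text \<open>A product lowers both the remaining length and the order, an averaging only the length,
  so the number of averagings is always \<open>length xi - r\<close>. A node (h,h) contributes the
  empty word, since every entry has the same law; the products it saves are the reason for the mere
  inequality on \<open>False\<close>.\<close>

lemma map_stat_replicate_pmf:
  assumes "r \<le> length xi" "xi \<noteq> []"
  shows "\<exists>w. count_list w True = length xi - r \<and> count_list w False \<le> r \<and>
     (\<forall>p. map_pmf (stat r xi) (replicate_pmf (2 ^ length xi) p) = law w p)"
  using assms
proof (induction xi arbitrary: r)
  case (Cons b bs)
  let ?N = "2 ^ length (b # bs) :: nat"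
  consider "r = 0" | "r = length (b # bs)" | "r \<noteq> 0" "r < length (b # bs)"
    using Cons.prems by linarith
  then show ?case
  proof cases
    case 1
    let ?w = "replicate (length (b # bs)) True"
    have "map_pmf (stat r (b # bs)) (replicate_pmf ?N p) = law ?w p" for p
      unfolding law_replicate_True using 1
      by (intro map_pmf_cong refl) (auto simp: set_replicate_pmf)
    moreover have "count_list ?w True = length (b # bs)" "count_list ?w False = 0"
      by (simp_all only: count_list_replicate) auto
    ultimately show ?thesis
      using 1 by (intro exI[of _ ?w] conjI allI) (simp_all only: diff_zero le_refl)
  next
    case 2
    have "map_pmf (stat r (b # bs)) (replicate_pmf ?N p) =
        map_pmf (\<lambda>v. v ! bits_to_nat (b # bs)) (replicate_pmf ?N p)" for p
      using 2 by (intro map_pmf_cong refl) (auto simp: set_replicate_pmf)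
    also have "\<dots> p = law [] p" for p
      unfolding map_nth_replicate_pmf[OF bits_to_nat_less] by simp
    finally have "\<forall>p. map_pmf (stat r (b # bs)) (replicate_pmf ?N p) = law [] p"
      by blast
    then show ?thesis
      by (intro exI[of _ "[]"] conjI; (assumption | simp add: 2))
  next
    case 3
    let ?r = "if b then r else r - 1"
    have "?r \<le> length bs" "bs \<noteq> []" using 3 by auto
    from Cons.IH[OF this] obtain w where w: "count_list w True = length bs - ?r"
      "count_list w False \<le> ?r"
      "\<And>p. map_pmf (stat ?r bs) (replicate_pmf (2 ^ length bs) p) = law w p" by blast
    have "map_pmf (stat r (b # bs)) (replicate_pmf ?N p) =
       map_pmf (stat ?r bs) (map_pmf (if b then half_avg else half_prod) (replicate_pmf ?N p))" for p
      unfolding pmf.map_comp using 3 by (intro map_pmf_cong refl) auto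
    also have "\<dots> p = law (b # w) p" for p
      using w(3) by (cases b) (simp_all add: half_avg_replicate half_prod_replicate)
    finally have "map_pmf (stat r (b # bs)) (replicate_pmf ?N p) = law (b # w) p" for p .
    moreover have "count_list (b # w) True = length (b # bs) - r" "count_list (b # w) False \<le> r"
      using w(1,2) 3 by auto
    ultimately show ?thesis by blast
  qed
qed auto

text \<open>For the asymptotic equality the word itself is needed, not only its letter counts:
  \<open>r\<close> products lead to the repetition node (m - r, 0).\<close>

lemma stat_xi_star:
  assumes "r < m"
  shows "map_pmf (stat r (xi_star r m)) (replicate_pmf (2 ^ m) p) =
     law (replicate r False @ replicate (m - r) True) p"
  using assms
proof (induction r arbitrary: m p)
  case 0
  then obtain k where m: "m = Suc k" by (cases m) auto
  have "map_pmf (stat 0 (xi_star 0 m)) (replicate_pmf (2 ^ m) p) =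
      map_pmf (\<lambda>v. sum_list v / 2 ^ m) (replicate_pmf (2 ^ m) p)"
    by (intro map_pmf_cong refl) (auto simp: m set_replicate_pmf xi_star_def)
  then show ?case by (simp add: law_replicate_True)
next
  case (Suc r)
  then obtain k where m: "m = Suc k" by (cases m) auto
  have "map_pmf (stat (Suc r) (xi_star (Suc r) m)) (replicate_pmf (2 ^ m) p) =
     map_pmf (stat r (xi_star r k)) (map_pmf half_prod (replicate_pmf (2 * 2 ^ k) p))"
    unfolding pmf.map_comp using Suc.prems
    by (intro map_pmf_cong refl) (auto simp: m xi_star_def)
  then show ?case
    using Suc.IH[of k] Suc.prems by (simp add: half_prod_replicate m)
qed

section \<open>Error probabilities as expectations\<close>

definition spin :: "real \<Rightarrow> real pmf" where
  "spin d = map_pmf (\<lambda>b. if b then 1 else - 1) (bernoulli_pmf ((1 + d) / 2))"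

definition err :: "real \<Rightarrow> real" where
  "err t = (if t < 0 then 1 else if t = 0 then 1 / 2 else 0)"

lemma replicate_pmf_map: "replicate_pmf n (map_pmf f p) = map_pmf (map f) (replicate_pmf n p)"
  by (induction n) (simp_all add: map_bind_pmf bind_map_pmf)

lemma pmf_replicate_pmf_Cons:
  "pmf (replicate_pmf (Suc n) p) (x # xs) = pmf p x * pmf (replicate_pmf n p) xs"
proof -
  have "replicate_pmf (Suc n) p = map_pmf (\<lambda>(x, xs). x # xs) (pair_pmf p (replicate_pmf n p))"
    by (simp add: pair_pmf_def map_bind_pmf)
  then have "pmf (replicate_pmf (Suc n) p) ((\<lambda>(x, xs). x # xs) (x, xs)) =
      pmf (pair_pmf p (replicate_pmf n p)) (x, xs)"
    by (simp only:) (rule pmf_map_inj', auto simp: inj_on_def)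
  then show ?thesis by (simp add: pmf_pair)
qed

lemma pmf_replicate_bernoulli:
  assumes "0 \<le> e" "e \<le> 1"
  shows "pmf (replicate_pmf (length s) (bernoulli_pmf ((1 + e) / 2))) s = sign_weight e s"
  using assms
proof (induction s)
  case (Cons b s)
  have "pmf (bernoulli_pmf ((1 + e) / 2)) b = (if b then (1 + e) / 2 else (1 - e) / 2)"
    using assms by (simp add: field_simps)
  then show ?case
    using Cons by (simp only: pmf_replicate_pmf_Cons list.size add_Suc_right add_0_right) 
      (simp add: sign_weight_def)
qed (simp add: sign_weight_def)

text \<open>Only the law of the statistic enters the error probability. The bounds on
  \<open>e\<close> make \<open>(1 + e) / 2\<close> a probability.\<close>

lemma perr_expectation:
  assumes "0 \<le> e" "e \<le> 1"
  shows "perr r m e xi =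
    measure_pmf.expectation (map_pmf (stat r xi) (replicate_pmf (2 ^ m) (spin e))) err"
proof -
  let ?B = "replicate_pmf (2 ^ m) (bernoulli_pmf ((1 + e) / 2))"
  have fin: "finite {s :: bool list. length s = 2 ^ m}"
    using finite_lists_length_eq[of "UNIV :: bool set"] by simp
  have "map_pmf (stat r xi) (replicate_pmf (2 ^ m) (spin e)) = map_pmf (\<lambda>s. stat r xi (to_pm s)) ?B"
    by (simp add: spin_def replicate_pmf_map pmf.map_comp o_def to_pm_def[abs_def])
  then have "measure_pmf.expectation (map_pmf (stat r xi) (replicate_pmf (2 ^ m) (spin e))) err =
      measure_pmf.expectation ?B (\<lambda>s. err (stat r xi (to_pm s)))"
    by simp
  also have "\<dots> = (\<Sum>s\<in>{s. length s = 2 ^ m}. err (stat r xi (to_pm s)) * pmf ?B s)"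
    by (rule integral_measure_pmf_real) (use fin in \<open>auto simp: set_replicate_pmf\<close>)
  also have "\<dots> = perr r m e xi"
    unfolding perr_def
  proof (rule sum.cong[OF refl])
    fix s :: "bool list" assume "s \<in> {s. length s = 2 ^ m}"
    then show "err (stat r xi (to_pm s)) * pmf ?B s = sign_weight e s *
        (let t = stat r xi (to_pm s) in if t < 0 then 1 else if t = 0 then 1 / 2 else 0)"
      using pmf_replicate_bernoulli[OF assms, of s] by (simp add: err_def Let_def)
  qed
  finally show ?thesis ..
qed

section \<open>Comparison of paths in the convex order\<close>

abbreviation expect :: "'a pmf \<Rightarrow> ('a \<Rightarrow> real) \<Rightarrow> real" where
  "expect p f \<equiv> measure_pmf.expectation p f"

text \<open>The convex order of laws. All convex functions serve as tests, since the laws compared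
  below have finite support and all expectations exist.\<close>

definition convex_le :: "real pmf \<Rightarrow> real pmf \<Rightarrow> bool" where
  "convex_le p q \<longleftrightarrow> (\<forall>f. convex_on UNIV f \<longrightarrow> expect p f \<le> expect q f)"

lemma convex_le_refl: "convex_le p p"
  by (simp add: convex_le_def)

lemma convex_le_trans [trans]: "convex_le p q \<Longrightarrow> convex_le q s \<Longrightarrow> convex_le p s"
  unfolding convex_le_def by (meson order_trans)

lemma finite_set_pmf_step: "finite (set_pmf p) \<Longrightarrow> finite (set_pmf (step b p))"
  by (simp add: step_def)

lemma finite_set_pmf_law: "finite (set_pmf p) \<Longrightarrow> finite (set_pmf (law w p))"
  by (induction w arbitrary: p) (auto simp: finite_set_pmf_step)

section \<open>Expectations over finite supports\<close>

lemma expect_add: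
  "finite (set_pmf p) \<Longrightarrow> expect p (\<lambda>x. f x + g x) = expect p f + expect p g"
  by (rule Bochner_Integration.integral_add) (auto intro: integrable_measure_pmf_finite)

lemma expect_mono:
  "finite (set_pmf p) \<Longrightarrow> (\<And>x. f x \<le> g x) \<Longrightarrow> expect p f \<le> expect p g"
  by (rule integral_mono) (auto intro: integrable_measure_pmf_finite)

lemma expect_commute:
  assumes "finite (set_pmf p)" "finite (set_pmf q)"
  shows "expect p (\<lambda>x. expect q (\<lambda>y. f x y)) = expect q (\<lambda>y. expect p (\<lambda>x. f x y))"
proof -
  have "expect p (\<lambda>x. expect q (\<lambda>y. f x y)) =
      (\<Sum>x\<in>set_pmf p. \<Sum>y\<in>set_pmf q. f x y * pmf q y * pmf p x)"
    using assms by (simp add: integral_measure_pmf_real[OF assms(1)]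
      integral_measure_pmf_real[OF assms(2)] sum_distrib_right)
  also have "\<dots> = (\<Sum>y\<in>set_pmf q. \<Sum>x\<in>set_pmf p. f x y * pmf p x * pmf q y)"
    by (subst sum.swap) (simp add: mult_ac)
  also have "\<dots> = expect q (\<lambda>y. expect p (\<lambda>x. f x y))"
    using assms by (simp add: integral_measure_pmf_real[OF assms(1)]
      integral_measure_pmf_real[OF assms(2)] sum_distrib_right)
  finally show ?thesis .
qed

lemma expect_bind:
  assumes "finite (set_pmf p)" "\<And>x. x \<in> set_pmf p \<Longrightarrow> finite (set_pmf (q x))"
  shows "expect (bind_pmf p q) f = expect p (\<lambda>x. expect (q x) f)"
proof -
  have "expect (bind_pmf p q) f = (\<Sum>x\<in>set_pmf p. pmf p x *\<^sub>R expect (q x) f)"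
    by (rule pmf_expectation_bind) (use assms in auto)
  also have "\<dots> = expect p (\<lambda>x. expect (q x) f)"
    by (rule integral_measure_pmf[symmetric]) (use assms in auto)
  finally show ?thesis .
qed

lemma expect_step:
  assumes "finite (set_pmf p)"
  shows "expect (step b p) f = expect p (\<lambda>x. expect p (\<lambda>y. f (combine b x y)))"
  using assms unfolding step_def by (simp add: expect_bind)

lemma combine_commute: "combine b x y = combine b y x"
  by (auto simp: combine_def)

text \<open>\<open>combine\<close> is affine in each argument separately.\<close>

lemma convex_on_combine:
  assumes "convex_on UNIV f"
  shows "convex_on UNIV (\<lambda>x. f (combine b x y))" "convex_on UNIV (\<lambda>x. f (combine b y x))"
proof -
  show left: "convex_on UNIV (\<lambda>x. f (combine b x y))" for y
  proof (rule convex_onI)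
    fix t x x' :: real assume t: "0 < t" "t < 1"
    have "combine b ((1 - t) *\<^sub>R x + t *\<^sub>R x') y =
        (1 - t) *\<^sub>R combine b x y + t *\<^sub>R combine b x' y"
      by (cases b) (simp_all add: combine_def field_simps)
    then show "f (combine b ((1 - t) *\<^sub>R x + t *\<^sub>R x') y) \<le>
        (1 - t) * f (combine b x y) + t * f (combine b x' y)"
      using convex_onD[OF assms, of t "combine b x y" "combine b x' y"] t by simp
  qed simp
  show "convex_on UNIV (\<lambda>x. f (combine b y x))"
  proof -
    have "(\<lambda>x. f (combine b y x)) = (\<lambda>x. f (combine b x y))"
      by (intro ext arg_cong[of _ _ f] combine_commute)
    then show ?thesis using left[of y] by (simp only:)
  qed
qed

text \<open>The two copies are replaced one at a time: with one argument frozen, the test function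
  is convex in the other. Exchanging the expectations gives access to the second copy.\<close>

lemma convex_le_step:
  assumes fin: "finite (set_pmf p)" "finite (set_pmf q)" and le: "convex_le p q"
  shows "convex_le (step b p) (step b q)"
  unfolding convex_le_def
proof (intro allI impI)
  fix f :: "real \<Rightarrow> real" assume f: "convex_on UNIV f"
  have "expect (step b p) f = expect p (\<lambda>x. expect p (\<lambda>y. f (combine b x y)))"
    using fin by (simp add: expect_step)
  also have "\<dots> \<le> expect p (\<lambda>x. expect q (\<lambda>y. f (combine b x y)))"
    using le convex_on_combine(2)[OF f] by (intro expect_mono fin) (auto simp: convex_le_def)
  also have "\<dots> = expect q (\<lambda>y. expect p (\<lambda>x. f (combine b x y)))"
    by (rule expect_commute[OF fin])
  also have "\<dots> \<le> expect q (\<lambda>y. expect q (\<lambda>x. f (combine b x y)))"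
    using le convex_on_combine(1)[OF f] by (intro expect_mono fin) (auto simp: convex_le_def)
  also have "\<dots> = expect (step b q) f"
    by (subst expect_commute[OF fin(2) fin(2)]) (simp add: expect_step fin)
  finally show "expect (step b p) f \<le> expect (step b q) f" .
qed

lemma convex_le_law:
  "finite (set_pmf p) \<Longrightarrow> finite (set_pmf q) \<Longrightarrow> convex_le p q \<Longrightarrow> convex_le (law w p) (law w q)"
  by (induction w arbitrary: p q) (auto simp: convex_le_step finite_set_pmf_step)

text \<open>The product of two averages is itself the average of two pairings, each of them distributed
  as the average of two products, so the claim is Jensen's inequality.\<close>

lemma convex_le_swap:
  assumes fin: "finite (set_pmf p)"
  shows "convex_le (law [True, False] p) (law [False, True] p)"
  unfolding convex_le_def
proof (intro allI impI)
  fix f :: "real \<Rightarrow> real" assume f: "convex_on UNIV f"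
  let ?E = "\<lambda>F. expect p (\<lambda>x. expect p (\<lambda>y. expect p (\<lambda>z. expect p (\<lambda>w. F x y z w))))"
  let ?U = "\<lambda>x y z w. f ((x * z + y * w) / 2)" and ?V = "\<lambda>x y z w. f ((x * w + y * z) / 2)"
  have conv: "f ((x + y) / 2 * ((z + w) / 2)) \<le> 1 / 2 * ?U x y z w + 1 / 2 * ?V x y z w" for x y z w
  proof -
    have le: "f ((1 - 1 / 2) *\<^sub>R ((x * z + y * w) / 2) + (1 / 2) *\<^sub>R ((x * w + y * z) / 2)) \<le>
       (1 - 1 / 2) * ?U x y z w + 1 / 2 * ?V x y z w"
      by (rule convex_onD[OF f]) auto
    have eq: "(1 - 1 / 2) *\<^sub>R ((x * z + y * w) / 2) + (1 / 2) *\<^sub>R ((x * w + y * z) / 2) =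
        (x + y) / 2 * ((z + w) / 2)"
      by (simp add: field_simps)
    show ?thesis using le unfolding eq by simp
  qed
  have "expect (law [True, False] p) f = ?E (\<lambda>x y z w. f ((x + y) / 2 * ((z + w) / 2)))"
    using fin by (simp only: law.simps expect_step finite_set_pmf_step combine_def if_True if_False)
  also have "\<dots> \<le> ?E (\<lambda>x y z w. 1 / 2 * ?U x y z w + 1 / 2 * ?V x y z w)"
    by (intro expect_mono fin conv)
  also have "\<dots> = 1 / 2 * ?E ?U + 1 / 2 * ?E ?V"
    using fin by (simp add: expect_add)
  also have "?E ?V = ?E ?U"
  proof -
    have "expect p (\<lambda>z. expect p (\<lambda>w. ?V x y z w)) = expect p (\<lambda>z. expect p (\<lambda>w. ?U x y z w))" for x y
      by (rule expect_commute[OF fin fin])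
    then show ?thesis by (simp only:)
  qed
  also have "1 / 2 * ?E ?U + 1 / 2 * ?E ?U = ?E ?U"
    by simp
  also have "?E ?U = expect p (\<lambda>x. expect p (\<lambda>z. expect p (\<lambda>y. expect p (\<lambda>w. ?U x y z w))))"
  proof -
    have "expect p (\<lambda>y. expect p (\<lambda>z. expect p (\<lambda>w. ?U x y z w))) =
        expect p (\<lambda>z. expect p (\<lambda>y. expect p (\<lambda>w. ?U x y z w)))" for x
      by (rule expect_commute[OF fin fin])
    then show ?thesis by (simp only:)
  qed
  also have "\<dots> = expect (law [False, True] p) f"
    using fin by (simp only: law.simps expect_step finite_set_pmf_step combine_def if_True if_False)
  finally show "expect (law [True, False] p) f \<le> expect (law [False, True] p) f" .
qed

lemma convex_le_swap_in_word:
  assumes fin: "finite (set_pmf p)"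
  shows "convex_le (law (u @ [True, False] @ v) p) (law (u @ [False, True] @ v) p)"
  unfolding law_append
  by (rule convex_le_law; intro convex_le_swap finite_set_pmf_law fin)

text \<open>Adjacent swaps carry one averaging to the right past \<open>k\<close> products.\<close>

lemma convex_le_move:
  assumes fin: "finite (set_pmf p)"
  shows "convex_le (law (u @ True # replicate k False @ v) p) (law (u @ replicate k False @ True # v) p)"
proof (induction k arbitrary: u)
  case 0
  then show ?case by (simp add: convex_le_refl)
next
  case (Suc k)
  have "convex_le (law (u @ [True, False] @ replicate k False @ v) p)
                  (law (u @ [False, True] @ replicate k False @ v) p)"
    by (rule convex_le_swap_in_word[OF fin])
  also have "convex_le \<dots> (law ((u @ [False]) @ replicate k False @ True # v) p)"
    using Suc.IH[of "u @ [False]"] by simp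
  finally show ?case by simp
qed

text \<open>Insertion sort by such moves: doing all products first is the worst order for given
  letter counts.\<close>

lemma convex_le_sorted:
  assumes "finite (set_pmf p)"
  shows "convex_le (law w p)
    (law (replicate (count_list w False) False @ replicate (count_list w True) True) p)"
  using assms
proof (induction w arbitrary: p)
  case (Cons b w)
  let ?k = "count_list w False" and ?l = "count_list w True"
  have IH: "convex_le (law (b # w) p) (law (b # replicate ?k False @ replicate ?l True) p)"
    using Cons.IH[of "step b p"] Cons.prems by (simp add: finite_set_pmf_step)
  show ?case
  proof (cases b)
    case True
    note IH
    also have "convex_le (law (b # replicate ?k False @ replicate ?l True) p)
        (law (replicate ?k False @ True # replicate ?l True) p)"
      using convex_le_move[OF Cons.prems, of "[]"] True by simp
    finally show ?thesis using True by simp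
  qed (use IH in simp)
qed (simp add: convex_le_refl)

text \<open>An unsorted word has an averaging before some product. Sorting can stop one swap early,
  at the word with a single inversion left. Leading products are stripped until the first averaging
  is reached.\<close>

lemma convex_le_almost_sorted:
  assumes "finite (set_pmf p)" "count_list w False = Suc k" "count_list w True = Suc l"
    "w \<noteq> replicate (Suc k) False @ replicate (Suc l) True"
  shows "convex_le (law w p) (law (replicate k False @ [True, False] @ replicate l True) p)"
  using assms
proof (induction w arbitrary: p k)
  case (Cons b w)
  note fin = Cons.prems(1)
  show ?case
  proof (cases b)
    case True
    have k: "count_list w False = Suc k" and l: "count_list w True = l"
      using Cons.prems True by auto
    have "convex_le (law (b # w) p) (law (True # replicate (Suc k) False @ replicate l True) p)"
      using convex_le_sorted[of "step b p" w] fin True unfolding k l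
      by (simp add: finite_set_pmf_step)
    \<comment> \<open>The last of the \<open>Suc k\<close> products is split off, so that the
      leading averaging moves past \<open>k\<close> products only and stops just before it.\<close>
    also have "True # replicate (Suc k) False @ replicate l True =
        [] @ True # replicate k False @ False # replicate l True"
      using replicate_append_same[of k False] by simp
    also have "convex_le (law \<dots> p) (law ([] @ replicate k False @ True # False # replicate l True) p)"
      by (rule convex_le_move[OF fin])
    finally show ?thesis by simp
  next
    case False
    have k: "count_list w False = k" and l: "count_list w True = Suc l"
      and ne: "w \<noteq> replicate k False @ replicate (Suc l) True"
      using Cons.prems False by auto
    \<comment> \<open>With no product left, the rest would consist of averagings and be sorted,
      against \<open>ne\<close>.\<close>
    have "k \<noteq> 0"
    proof
      assume "k = 0"
      then have "False \<notin> set w" using k by (simp add: count_list_0_iff)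
      then have "w = replicate (length w) True"
        by (intro replicate_eqI) (metis (full_types))+
      then have "w = replicate (count_list w True) True"
        by (metis count_list_replicate)
      then show False using ne l \<open>k = 0\<close> by simp
    qed
    then obtain k' where k': "k = Suc k'" by (cases k) auto
    show ?thesis
      using Cons.IH[of "step b p" k'] fin k l ne False unfolding k'
      by (simp add: finite_set_pmf_step)
  qed
qed simp

section \<open>Products of signs and Chernoff bounds\<close>

lemma finite_set_pmf_spin [simp]: "finite (set_pmf (spin d))"
  by (simp add: spin_def)

lemma expect_spin:
  assumes "0 \<le> d" "d \<le> 1"
  shows "expect (spin d) f = (1 + d) / 2 * f 1 + (1 - d) / 2 * f (- 1)"
proof -
  have eq: "1 - (1 + d) / 2 = (1 - d) / 2" by (simp add: field_simps)
  have "expect (spin d) f = f 1 * ((1 + d) / 2) + f (- 1) * (1 - (1 + d) / 2)"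
    using assms by (simp add: spin_def)
  then show ?thesis unfolding eq by (simp add: mult.commute)
qed

lemma pmf_eqI_expect:
  assumes "finite (set_pmf p)" "finite (set_pmf q)" "\<And>f. expect p f = expect q f"
  shows "p = q"
proof (rule pmf_eqI)
  fix x
  have "expect p (indicator {x}) = expect q (indicator {x})" by (rule assms(3))
  then show "pmf p x = pmf q x" by (simp add: pmf.rep_eq)
qed

text \<open>A product of independent signs is a sign, and the means multiply; hence the
  parametrisation of \<open>spin\<close> by its mean.\<close>

lemma step_False_spin:
  assumes "0 \<le> d" "d \<le> 1"
  shows "step False (spin d) = spin (d\<^sup>2)"
proof (rule pmf_eqI_expect)
  have "d\<^sup>2 \<le> 1" using assms by (simp add: power_le_one)
  then show "expect (step False (spin d)) f = expect (spin (d\<^sup>2)) f" for f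
    using assms
    by (simp add: expect_step expect_spin combine_def) (simp add: field_simps power2_eq_square)
qed (auto simp: finite_set_pmf_step)

lemma law_False_spin:
  assumes "0 \<le> d" "d \<le> 1"
  shows "law (replicate k False) (spin d) = spin (d ^ 2 ^ k)"
  using assms
proof (induction k arbitrary: d)
  case (Suc k)
  have "d\<^sup>2 \<le> 1" using Suc.prems by (simp add: power_le_one)
  then show ?case using Suc.IH[of "d\<^sup>2"] Suc.prems
    by (simp add: step_False_spin power_mult)
qed simp

text \<open>The law is that of an average of \<open>2 ^ l\<close> independent copies; the factor
  \<open>2 ^ l\<close> in the exponent cancels the division, and the transform factorises.\<close>

lemma expect_exp_law_True:
  assumes "finite (set_pmf p)"
  shows "expect (law (replicate l True) p) (\<lambda>x. exp (- (2 ^ l * s * x))) = (expect p (\<lambda>x. exp (- (s * x)))) ^ 2 ^ l"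
  using assms
proof (induction l arbitrary: p s)
  case (Suc l)
  have "expect (step True p) (\<lambda>x. exp (- ((2 * s) * x))) =
      expect p (\<lambda>x. expect p (\<lambda>y. exp (- (s * x)) * exp (- (s * y))))"
  proof -
    have "exp (- ((2 * s) * combine True x y)) = exp (- (s * x)) * exp (- (s * y))" for x y
      by (simp add: combine_def exp_add[symmetric] algebra_simps)
    then show ?thesis using Suc.prems by (simp only: expect_step)
  qed
  also have "\<dots> = (expect p (\<lambda>x. exp (- (s * x))))\<^sup>2"
    by (simp add: power2_eq_square)
  finally show ?case
    using Suc.IH[of "step True p" "2 * s"] Suc.prems
    by (simp add: finite_set_pmf_step power_mult mult_ac)
qed simp

lemma convex_on_exp_scale: "convex_on UNIV (\<lambda>x::real. exp (- (t * x)))"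
proof -
  have "convex_on UNIV (\<lambda>x::real. exp (- t * x))"
    by (rule f''_ge0_imp_convex[where f' = "\<lambda>x. - t * exp (- t * x)" and f'' = "\<lambda>x. t\<^sup>2 * exp (- t * x)"])
       (auto intro!: derivative_eq_intros simp: power2_eq_square)
  then show ?thesis by simp
qed

text \<open>\<open>err\<close> is not convex, so it is first bounded by an exponential, which is;
  the convex order then carries the Chernoff bound over.\<close>

lemma expect_err_le:
  assumes "finite (set_pmf p)" "finite (set_pmf q)" "t \<ge> 0" "convex_le p (law (replicate l True) q)"
  shows "expect p err \<le> (expect q (\<lambda>x. exp (- (t * x)))) ^ 2 ^ l"
proof -
  have "err x \<le> exp (- (2 ^ l * t * x))" for x
  proof (cases "x \<le> 0")
    case True
    then have "0 \<le> - (2 ^ l * t * x)" using assms(3) by (simp add: mult_nonneg_nonpos)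
    then have "1 \<le> exp (- (2 ^ l * t * x))" by (simp only: one_le_exp_iff)
    then show ?thesis by (simp add: err_def)
  qed (simp add: err_def)
  then have "expect p err \<le> expect p (\<lambda>x. exp (- (2 ^ l * t * x)))"
    by (intro expect_mono assms)
  also have "\<dots> \<le> expect (law (replicate l True) q) (\<lambda>x. exp (- (2 ^ l * t * x)))"
    using assms(4) convex_on_exp_scale[of "2 ^ l * t"] by (simp add: convex_le_def)
  finally show ?thesis using expect_exp_law_True[OF assms(2)] by simp
qed

section \<open>The error probability of a repetition code\<close>

text \<open>The number of positive signs among \<open>2 * M\<close> is binomial, and the average is
  negative iff that number is below \<open>M\<close>. The first term is the half weight of a
  tie.\<close>

lemma expect_err_law_spin:
  assumes "0 \<le> d" "d < 1"
  defines "P \<equiv> (1 + d) / 2" and "Q \<equiv> (1 - d) / 2"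
  assumes M: "2 ^ n = 2 * M"
  shows "expect (law (replicate n True) (spin d)) err =
    real (2 * M choose M) * (P * Q) ^ M / 2 + (\<Sum>k<M. real (2 * M choose k) * P ^ k * Q ^ (2 * M - k))"
proof -
  let ?B = "bernoulli_pmf P"
  let ?pm = "\<lambda>b. if b then 1 else - 1 :: real"
  have P: "P \<in> {0..1}" "1 - P = Q" using assms by (auto simp: field_simps)
  have count: "sum_list (map ?pm s) = 2 * real (length (filter id s)) - real (length s)" for s
    by (induction s) auto
  have "law (replicate n True) (spin d) =
      map_pmf (\<lambda>s. sum_list (map ?pm s) / 2 ^ n) (replicate_pmf (2 * M) ?B)"
    unfolding law_replicate_True spin_def replicate_pmf_map P_def M by (simp add: pmf.map_comp o_def)
  also have "\<dots> = map_pmf (\<lambda>s. (2 * real (length (filter id s)) - 2 * M) / 2 ^ n) (replicate_pmf (2 * M) ?B)"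
    by (intro map_pmf_cong refl) (auto simp: set_replicate_pmf count)
  also have "\<dots> = map_pmf (\<lambda>k. (2 * real k - 2 * M) / 2 ^ n) (binomial_pmf (2 * M) P)"
    unfolding binomial_pmf_altdef[OF P(1)] by (simp add: pmf.map_comp o_def)
  finally have "expect (law (replicate n True) (spin d)) err =
      expect (binomial_pmf (2 * M) P) (\<lambda>k. err ((2 * real k - 2 * M) / 2 ^ n))"
    by simp
  also have "(\<lambda>k. err ((2 * real k - 2 * M) / 2 ^ n)) = (\<lambda>k. if k < M then 1 else if k = M then 1 / 2 else 0)"
    by (auto simp: fun_eq_iff err_def divide_less_0_iff)
  also have "expect (binomial_pmf (2 * M) P) \<dots> =
     (\<Sum>k\<le>2 * M. real (2 * M choose k) * P ^ k * Q ^ (2 * M - k) * (if k < M then 1 else if k = M then 1 / 2 else 0))"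
    using P by (simp add: expectation_binomial_pmf')
  also have "\<dots> = (\<Sum>k\<in>insert M {..<M}. real (2 * M choose k) * P ^ k * Q ^ (2 * M - k) * (if k < M then 1 else if k = M then 1 / 2 else 0))"
    by (rule sum.mono_neutral_right) auto
  also have "\<dots> = real (2 * M choose M) * (P * Q) ^ M / 2 + (\<Sum>k<M. real (2 * M choose k) * P ^ k * Q ^ (2 * M - k))"
    by (subst sum.insert) (auto simp: power_mult_distrib mult_2)
  finally show ?thesis .
qed

text \<open>Terms are indexed by their distance \<open>Suc i\<close> below the centre; moving one
  place down exchanges a factor \<open>P\<close> for a factor \<open>Q\<close>.\<close>

lemma binomial_tail_factor:
  fixes P Q :: real
  assumes "P > 0" "Q \<ge> 0"
  shows "(\<Sum>k<M. real (2 * M choose k) * P ^ k * Q ^ (2 * M - k)) =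
    (P * Q) ^ M * (\<Sum>i<M. real (2 * M choose (M - Suc i)) * (Q / P) ^ Suc i)"
proof -
  have "(\<Sum>k<M. real (2 * M choose k) * P ^ k * Q ^ (2 * M - k)) =
     (\<Sum>i<M. real (2 * M choose (M - Suc i)) * P ^ (M - Suc i) * Q ^ (2 * M - (M - Suc i)))"
    by (rule sum.nat_diff_reindex[symmetric])
  also have "\<dots> = (\<Sum>i<M. (P * Q) ^ M * (real (2 * M choose (M - Suc i)) * (Q / P) ^ Suc i))"
  proof (rule sum.cong[OF refl])
    fix i assume "i \<in> {..<M}"
    then have i: "Suc i \<le> M" by auto
    have "P ^ (M - Suc i) = P ^ M / P ^ Suc i" using i assms by (simp only: power_diff)
    moreover have "2 * M - (M - Suc i) = M + Suc i" using i by auto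
    ultimately show "real (2 * M choose (M - Suc i)) * P ^ (M - Suc i) * Q ^ (2 * M - (M - Suc i)) =
       (P * Q) ^ M * (real (2 * M choose (M - Suc i)) * (Q / P) ^ Suc i)"
      by (simp only: power_add power_mult_distrib power_divide times_divide_eq_right times_divide_eq_left mult_ac)
  qed
  finally show ?thesis by (simp only: sum_distrib_left)
qed

lemma binomial_below_center_step:
  assumes "Suc j \<le> M"
  shows "real (2 * M choose (M - Suc j)) * real (M + j + 1) = real (2 * M choose (M - j)) * real (M - j)"
proof -
  define k where "k = M - Suc j"
  have k: "M - j = Suc k" "2 * M - k = M + j + 1" using assms by (auto simp: k_def)
  have "Suc k * (2 * M choose Suc k) = (2 * M - k) * (2 * M choose k)"
    using binomial_absorption[of k "2 * M"] binomial_absorb_comp[of "2 * M" k] by simp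
  then have "real (Suc k * (2 * M choose Suc k)) = real ((2 * M - k) * (2 * M choose k))"
    by (simp only:)
  then show ?thesis unfolding k k_def[symmetric] by (simp only: of_nat_mult mult.commute)
qed

text \<open>Going from distance \<open>j\<close> to \<open>Suc j\<close> costs at most
  \<open>(2 j + 1) / M\<close> times the central coefficient, and the first \<open>j\<close> odd
  numbers sum to \<open>j\<^sup>2\<close>.\<close>

lemma binomial_below_center_ge:
  assumes "j \<le> M"
  shows "real (2 * M choose (M - j)) \<ge> (1 - real j ^ 2 / real M) * real (2 * M choose M)"
  using assms
proof (induction j)
  case (Suc j)
  define C where "C = real (2 * M choose M)"
  define c where "c = real (2 * M choose (M - j))"
  have M: "real M > 0" using Suc.prems by simp
  have "c \<le> C" unfolding c_def C_def using binomial_maximum'[of M "M - j"] by simp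
  have IH: "c \<ge> (1 - real j ^ 2 / real M) * C"
    using Suc by (simp add: c_def C_def)
  have "real (2 * M choose (M - Suc j)) = c * (real (M - j) / real (M + j + 1))"
    using binomial_below_center_step[OF Suc.prems] by (simp add: c_def field_simps)
  also have "real (M - j) / real (M + j + 1) = 1 - (2 * real j + 1) / real (M + j + 1)"
    using Suc.prems by (simp add: field_simps)
  also have "c * (1 - (2 * real j + 1) / real (M + j + 1)) \<ge> c * (1 - (2 * real j + 1) / real M)"
    using M by (intro mult_left_mono diff_left_mono divide_left_mono) (auto simp: c_def)
  finally have "real (2 * M choose (M - Suc j)) \<ge> c - c * ((2 * real j + 1) / real M)"
    by (simp add: algebra_simps)
  moreover have "c * ((2 * real j + 1) / real M) \<le> C * ((2 * real j + 1) / real M)"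
    using \<open>c \<le> C\<close> by (intro mult_right_mono) auto
  ultimately have "real (2 * M choose (M - Suc j)) \<ge>
      (1 - real j ^ 2 / real M) * C - C * ((2 * real j + 1) / real M)"
    using IH by linarith
  also have "(1 - real j ^ 2 / real M) * C - C * ((2 * real j + 1) / real M) = (1 - real (Suc j) ^ 2 / real M) * C"
    using M by (simp add: field_simps power2_eq_square)
  finally show ?case by (simp add: C_def)
qed simp

text \<open>The explicit remainder makes the induction plain algebra; it is nonnegative for
  \<open>0 \<le> \<rho> < 1\<close> and can then be dropped.\<close>

lemma sum_squares_geometric_eq:
  fixes \<rho> :: real
  shows "(1 - \<rho>) ^ 3 * (\<Sum>i<M. real (Suc i) ^ 2 * \<rho> ^ Suc i) =
    \<rho> * (1 + \<rho>) - \<rho> ^ Suc M * ((1 - \<rho>)\<^sup>2 * real M ^ 2 + 2 * (1 - \<rho>) * real M + 1 + \<rho>)"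
proof (induction M)
  case (Suc M)
  show ?case
    unfolding sum.lessThan_Suc distrib_left Suc.IH
    by (simp add: algebra_simps power2_eq_square power3_eq_cube)
qed simp

lemma sum_squares_geometric_le:
  fixes \<rho> :: real
  assumes "0 \<le> \<rho>" "\<rho> < 1"
  shows "(\<Sum>i<M. real (Suc i) ^ 2 * \<rho> ^ Suc i) \<le> 2 / (1 - \<rho>) ^ 3"
proof -
  have "(1 - \<rho>) ^ 3 * (\<Sum>i<M. real (Suc i) ^ 2 * \<rho> ^ Suc i) \<le> \<rho> * (1 + \<rho>)"
    unfolding sum_squares_geometric_eq using assms by simp
  also have "\<dots> \<le> 1 * 2" using assms by (intro mult_mono) auto
  finally show ?thesis using assms by (simp add: field_simps)
qed

text \<open>No power \<open>\<rho> ^ i\<close> with \<open>i < M\<close> is below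
  \<open>\<rho> ^ M\<close>, so \<open>M\<close> copies of the latter are at most the geometric
  sum.\<close>

lemma real_mult_power_le:
  fixes \<rho> :: real
  assumes "0 \<le> \<rho>" "\<rho> < 1"
  shows "real M * \<rho> ^ M \<le> 1 / (1 - \<rho>)"
proof -
  have "real M * \<rho> ^ M = (\<Sum>i<M. \<rho> ^ M)" by simp
  also have "\<dots> \<le> (\<Sum>i<M. \<rho> ^ i)"
    using assms by (intro sum_mono power_decreasing) auto
  also have "\<dots> = (1 - \<rho> ^ M) / (1 - \<rho>)"
    using assms by (simp add: sum_gp_strict)
  also have "\<dots> \<le> 1 / (1 - \<rho>)"
    using assms by (intro divide_right_mono) auto
  finally show ?thesis .
qed

text \<open>On the scale \<open>j \<approx> 1 / d\<close> that dominates the tail sum the binomial coefficients are nearly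
  constant, which turns the tail into a geometric series of sum \<open>1 / (2 d)\<close>; the half weight of
  a tie removes the lower order term exactly.\<close>

lemma expect_err_spin_bounds:
  assumes d: "0 < d" "d < 1" and M: "2 ^ n = 2 * M"
  defines "c \<equiv> real (2 * M choose M) / 4 ^ M"
  defines "p \<equiv> expect (law (replicate n True) (spin d)) err"
  shows "p \<le> (1 - d\<^sup>2) ^ M * c / (2 * d)"
    and "p \<ge> (1 - d\<^sup>2) ^ M * c / (2 * d) * (1 - 6 / (real M * d\<^sup>2))"
proof -
  define \<rho> where "\<rho> = (1 - d) / (1 + d)"
  define C where "C = real (2 * M choose M)"
  define S where "S = (\<Sum>i<M. real (2 * M choose (M - Suc i)) * \<rho> ^ Suc i)"
  define u where "u = 1 / (1 - \<rho>)"
  define K where "K = (1 - d\<^sup>2) ^ M / 4 ^ M"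
  have \<rho>: "0 \<le> \<rho>" "\<rho> < 1" using d by (auto simp: \<rho>_def field_simps)
  have "(1::nat) \<le> 2 ^ n" by simp
  then have Mpos: "M > 0" using M by (cases M) auto
  have C: "C \<ge> 0" by (simp add: C_def)
  have u: "u = 1 / (2 * d) + 1 / 2" using d by (simp add: u_def \<rho>_def field_simps)
  have "u \<ge> 0" using d by (simp add: u)
  have "u \<le> 1 / d" using d by (simp add: u field_simps)
  have PQ: "((1 + d) / 2 * ((1 - d) / 2)) ^ M = K"
    by (simp add: K_def power_divide[symmetric] algebra_simps power2_eq_square)
  have K: "K \<ge> 0" using d by (simp add: K_def power_le_one)
  have ratio: "(1 - d) / 2 / ((1 + d) / 2) = \<rho>"
    using d by (simp add: \<rho>_def divide_simps) (simp add: algebra_simps)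
  have "p = C * K / 2 + K * S"
  proof -
    have "(\<Sum>k<M. real (2 * M choose k) * ((1 + d) / 2) ^ k * ((1 - d) / 2) ^ (2 * M - k)) = K * S"
      unfolding S_def PQ[symmetric] ratio[symmetric]
      by (rule binomial_tail_factor) (use d in auto)
    then show ?thesis
      unfolding p_def C_def expect_err_law_spin[OF less_imp_le[OF d(1)] d(2) M] PQ by (simp only:)
  qed
  then have p: "p = K * (C / 2 + S)" by (simp add: algebra_simps)
  have geo: "(\<Sum>i<M. \<rho> ^ Suc i) = (\<rho> - \<rho> ^ Suc M) * u"
    using \<rho> by (simp add: sum_distrib_left[symmetric] sum_gp_strict u_def field_simps)
  have u1: "\<rho> * u = u - 1" using \<rho> by (simp add: u_def field_simps)

  \<comment> \<open>Upper bound: every coefficient is replaced by the central one and the series is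
    completed. The resulting \<open>C * (u - 1)\<close> and the tie \<open>C / 2\<close> add up to
    exactly \<open>C / (2 * d)\<close>.\<close>
  have "S \<le> (\<Sum>i<M. C * \<rho> ^ Suc i)"
    unfolding S_def C_def using \<rho> binomial_maximum'[of M]
    by (intro sum_mono mult_right_mono) auto
  also have "\<dots> = C * ((\<rho> - \<rho> ^ Suc M) * u)" by (simp only: sum_distrib_left[symmetric] geo)
  also have "\<dots> \<le> C * (\<rho> * u)"
    using C \<rho> \<open>u \<ge> 0\<close> by (intro mult_left_mono mult_right_mono) auto
  finally have "S \<le> C * (u - 1)" unfolding u1 .
  then have "C / 2 + S \<le> C / (2 * d)"
    unfolding u by (simp add: algebra_simps)
  then have "p \<le> K * (C / (2 * d))"
    unfolding p using K by (rule mult_left_mono)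
  then show "p \<le> (1 - d\<^sup>2) ^ M * c / (2 * d)"
    by (simp add: K_def C_def c_def)

  \<comment> \<open>Lower bound: the errors are the quadratic loss in the coefficients and the
    missing tail \<open>\<rho> ^ Suc M * u\<close> of the series.\<close>
  have "S \<ge> (\<Sum>i<M. (1 - real (Suc i) ^ 2 / real M) * C * \<rho> ^ Suc i)"
    unfolding S_def C_def using \<rho>
    by (intro sum_mono mult_right_mono binomial_below_center_ge) auto
  also have "(\<Sum>i<M. (1 - real (Suc i) ^ 2 / real M) * C * \<rho> ^ Suc i) =
      C * ((\<Sum>i<M. \<rho> ^ Suc i) - (\<Sum>i<M. real (Suc i) ^ 2 * \<rho> ^ Suc i) / real M)"
    by (simp only: sum_distrib_left sum_subtractf[symmetric] sum_divide_distrib)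
       (intro sum.cong refl, simp add: algebra_simps)
  finally have S: "S \<ge> C * ((\<Sum>i<M. \<rho> ^ Suc i) - (\<Sum>i<M. real (Suc i) ^ 2 * \<rho> ^ Suc i) / real M)" .
  have "(\<Sum>i<M. real (Suc i) ^ 2 * \<rho> ^ Suc i) \<le> 2 * u ^ 3"
    using sum_squares_geometric_le[OF \<rho>, of M] by (simp add: u_def power_divide)
  also have "\<dots> \<le> 2 * (1 / d) ^ 3"
    using \<open>u \<ge> 0\<close> \<open>u \<le> 1 / d\<close> by (intro mult_left_mono power_mono) auto
  finally have sq: "(\<Sum>i<M. real (Suc i) ^ 2 * \<rho> ^ Suc i) / real M \<le> 2 * (1 / d) ^ 3 / real M"
    by (rule divide_right_mono) simp
  have "\<rho> ^ Suc M * u \<le> \<rho> ^ M * u"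
    using \<rho> \<open>u \<ge> 0\<close> by (intro mult_right_mono) (auto intro: mult_left_le_one_le)
  also have "\<rho> ^ M * u \<le> u / real M * u"
    using real_mult_power_le[OF \<rho>, of M] Mpos \<open>u \<ge> 0\<close>
    by (intro mult_right_mono) (auto simp: u_def[symmetric] field_simps)
  also have "\<dots> \<le> (1 / d) / real M * (1 / d)"
    using \<open>u \<ge> 0\<close> \<open>u \<le> 1 / d\<close> d by (intro mult_mono divide_right_mono) auto
  also have "\<dots> \<le> 1 / real M * (1 / d) ^ 3"
    using d Mpos by (simp add: field_simps power3_eq_cube)
  finally have tail: "\<rho> ^ Suc M * u \<le> 1 / real M * (1 / d) ^ 3" .
  \<comment> \<open>The two errors are at most \<open>2 / (M d\<^sup>3)\<close> and
    \<open>1 / (M d\<^sup>3)\<close>; together these are the fraction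
    \<open>6 / (M d\<^sup>2)\<close> of the main term \<open>1 / (2 d)\<close>.\<close>
  have "1 / (2 * d) * (1 - 6 / (real M * d\<^sup>2)) = u - 1 / 2 - 1 / real M * (1 / d) ^ 3 - 2 * (1 / d) ^ 3 / real M"
    unfolding u using d Mpos by (simp add: field_simps power2_eq_square power3_eq_cube)
  also have "\<dots> \<le> 1 / 2 + ((\<rho> - \<rho> ^ Suc M) * u - (\<Sum>i<M. real (Suc i) ^ 2 * \<rho> ^ Suc i) / real M)"
    using tail sq u1 by (simp add: left_diff_distrib)
  finally have "C * (1 / (2 * d) * (1 - 6 / (real M * d\<^sup>2))) \<le> C * \<dots>"
    using C by (rule mult_left_mono)
  also have "\<dots> \<le> C / 2 + S"
    using S unfolding geo by (simp add: algebra_simps)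
  finally have "K * (C * (1 / (2 * d) * (1 - 6 / (real M * d\<^sup>2)))) \<le> p"
    unfolding p using K by (rule mult_left_mono)
  then show "p \<ge> (1 - d\<^sup>2) ^ M * c / (2 * d) * (1 - 6 / (real M * d\<^sup>2))"
    by (simp add: K_def C_def c_def)
qed

section \<open>The central binomial coefficient\<close>

lemma central_binomial_Suc:
  "real (2 * Suc n choose Suc n) / 4 ^ Suc n =
   real (2 * n choose n) / 4 ^ n * ((2 * real n + 1) / (2 * real n + 2))"
proof -
  have "Suc n * (2 * Suc n choose Suc n) = 2 * Suc n * (Suc (2 * n) choose n)"
    using binomial_absorption[of n "2 * Suc n"] by simp
  moreover have "Suc n * (Suc (2 * n) choose n) = Suc (2 * n) * (2 * n choose n)"
    using binomial_absorb_comp[of "Suc (2 * n)" n] by simp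
  moreover define X Y Z where "X = (2 * Suc n choose Suc n)" and "Y = (2 * n choose n)"
    and "Z = (Suc (2 * n) choose n)"
  ultimately have "Suc n * X = 2 * Suc n * Z" "Suc n * Z = Suc (2 * n) * Y"
    by (simp_all only:)
  then have "Suc n * X = 2 * (Suc (2 * n) * Y)"
    by (simp only: mult.assoc)
  then have "real (Suc n * X) = real (2 * (Suc (2 * n) * Y))"
    by (simp only:)
  then have "real X = 2 * (2 * real n + 1) * real Y / (real n + 1)"
    by (simp add: field_simps)
  moreover have "2 * b * y / a / (4 * q) = y / q * (b / (2 * a))" for a b q y :: real
    by (simp add: field_simps)
  moreover have "2 * real n + 2 = 2 * (real n + 1)" by simp
  ultimately have "real X / 4 ^ Suc n = real Y / 4 ^ n * ((2 * real n + 1) / (2 * real n + 2))"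
    by (simp only: power_Suc)
  then show ?thesis unfolding X_def Y_def .
qed

text \<open>Wallis' product: with \<open>c n\<close> the normalised central coefficient, the partial
  product is exactly \<open>1 / (c n ^ 2 * (2 * n + 1))\<close>.\<close>

lemma central_binomial_tendsto:
  "(\<lambda>n. real (2 * n choose n) / 4 ^ n * sqrt (pi * real n)) \<longlonglongrightarrow> 1"
proof -
  define c where "c n = real (2 * n choose n) / 4 ^ n" for n
  have cpos: "c n > 0" for n by (simp add: c_def)
  have "(\<Prod>k=1..n. (4 * real k^2) / (4 * real k^2 - 1)) = 1 / (c n ^ 2 * (2 * real n + 1))" for n
  proof (induction n)
    case (Suc n)
    have "4 * real (Suc n)^2 - 1 = (2 * real n + 1) * (2 * real n + 3)"
      by (simp add: field_simps power2_eq_square)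
    moreover have c_Suc: "c (Suc n) = c n * ((2 * real n + 1) / (2 * real n + 2))"
      unfolding c_def by (rule central_binomial_Suc)
    moreover have "4 * real (Suc n)^2 = (2 * real n + 2)^2"
      by (simp add: field_simps power2_eq_square)
    ultimately have "(\<Prod>k=1..Suc n. (4 * real k^2) / (4 * real k^2 - 1)) =
        1 / (c n ^ 2 * (2 * real n + 1)) * ((2 * real n + 2)^2 / ((2 * real n + 1) * (2 * real n + 3)))"
      using Suc.IH by simp
    also have "\<dots> = 1 / ((c n * ((2 * real n + 1) / (2 * real n + 2))) ^ 2 * (2 * real (Suc n) + 1))"
      using cpos[of n] by (simp add: divide_simps power2_eq_square) 
    finally show ?case using c_Suc by simp
  qed (simp add: c_def)
  then have lim: "(\<lambda>n. 1 / (c n ^ 2 * (2 * real n + 1))) \<longlonglongrightarrow> pi / 2"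
    using wallis by simp
  have lim': "(\<lambda>n. pi * real n / (2 * real n + 1)) \<longlonglongrightarrow> pi / 2"
    by real_asymp
  have "(\<lambda>n. 1 / (1 / (c n ^ 2 * (2 * real n + 1))) * (pi * real n / (2 * real n + 1))) \<longlonglongrightarrow>
      1 / (pi / 2) * (pi / 2)"
    by (rule tendsto_mult[OF tendsto_divide[OF tendsto_const lim] lim']) simp
  moreover have "1 / (1 / (c n ^ 2 * (2 * real n + 1))) * (pi * real n / (2 * real n + 1)) = c n ^ 2 * (pi * real n)" for n
  proof -
    have "2 * real n + 1 \<noteq> 0" by linarith
    then show ?thesis by simp
  qed
  ultimately have "(\<lambda>n. sqrt (c n ^ 2 * (pi * real n))) \<longlonglongrightarrow> sqrt 1"
    by (intro tendsto_real_sqrt) simp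
  then show ?thesis
    using cpos by (simp add: real_sqrt_mult c_def[symmetric] less_imp_le)
qed

section \<open>Asymptotics\<close>

text \<open>The bound \<open>1 + x + x\<^sup>2\<close> on the exponential at \<open>x = t\<close>
  and \<open>x = - t\<close> gives \<open>1 - \<mu> t + t\<^sup>2\<close>, which is least at
  \<open>t = \<mu> / 2\<close>.\<close>

lemma expect_exp_spin_le:
  assumes "0 \<le> \<mu>" "\<mu> \<le> 1"
  shows "expect (spin \<mu>) (\<lambda>x. exp (- (\<mu> / 2 * x))) \<le> exp (- (\<mu>\<^sup>2 / 4))"
proof -
  define t where "t = \<mu> / 2"
  have t: "0 \<le> t" "t \<le> 1" "\<mu> = 2 * t" using assms by (auto simp: t_def)
  have plus: "exp t \<le> 1 + t + t\<^sup>2" using t by (intro exp_bound) auto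
  have "exp (- t) \<le> inverse (1 + t)"
    unfolding exp_minus using t by (intro le_imp_inverse_le) auto
  also have "\<dots> \<le> 1 - t + t\<^sup>2"
  proof -
    \<comment> \<open>The product equals \<open>1 + t ^ 3\<close>.\<close>
    have "1 \<le> (1 - t + t\<^sup>2) * (1 + t)"
      using t by (simp add: algebra_simps power2_eq_square)
    then show ?thesis using t by (simp add: inverse_eq_divide divide_le_eq)
  qed
  finally have minus: "exp (- t) \<le> 1 - t + t\<^sup>2" .
  have "expect (spin \<mu>) (\<lambda>x. exp (- (t * x))) = (1 + \<mu>) / 2 * exp (- t) + (1 - \<mu>) / 2 * exp t"
    using assms by (simp add: expect_spin)
  also have "\<dots> \<le> (1 + \<mu>) / 2 * (1 - t + t\<^sup>2) + (1 - \<mu>) / 2 * (1 + t + t\<^sup>2)"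
    using plus minus assms by (intro add_mono mult_left_mono) auto
  also have "\<dots> = 1 + - (\<mu>\<^sup>2 / 4)"
    by (simp add: t_def field_simps power2_eq_square)
  also have "\<dots> \<le> exp (- (\<mu>\<^sup>2 / 4))" by (rule exp_ge_add_one_self)
  finally show ?thesis by (simp add: t_def)
qed

text \<open>The Laplace transform at \<open>4 d\<close> of a product of two averages of two spins of mean
  \<open>\<mu>\<close>, where \<open>d = \<mu>\<^sup>2\<close>. It is \<open>1 - 2 d\<^sup>2 + O(d\<^sup>3)\<close>; the value \<open>4 d\<close> minimises the quadratic
  approximation.\<close>

definition mgf_swapped :: "real \<Rightarrow> real" where
  "mgf_swapped d = 1 + ((1 + d)\<^sup>2 / 4 - (1 - d)\<^sup>2 / 8) * (exp (- (4 * d)) - 1)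
     + (1 - d)\<^sup>2 / 8 * (exp (4 * d) - 1)"

text \<open>An average of two signs takes the values \<open>1\<close>, \<open>0\<close>,
  \<open>-1\<close>, and so does a product of two such averages. Its probabilities depend on
  \<open>\<mu>\<close> only through the mean \<open>\<mu>\<^sup>2\<close> of the product.\<close>

lemma expect_exp_swapped:
  assumes "0 \<le> \<mu>" "\<mu> \<le> 1"
  shows "expect (law [True, False] (spin \<mu>)) (\<lambda>x. exp (- (4 * \<mu>\<^sup>2 * x))) = mgf_swapped (\<mu>\<^sup>2)"
proof -
  define U where "U = step True (spin \<mu>)"
  define P Q where "P = (1 + \<mu>) / 2" and "Q = (1 - \<mu>) / 2"
  have U: "expect U f = P\<^sup>2 * f 1 + 2 * P * Q * f 0 + Q\<^sup>2 * f (- 1)" for f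
    using assms by (simp add: U_def expect_step expect_spin combine_def P_def[symmetric]
      Q_def[symmetric]) (simp add: algebra_simps power2_eq_square)
  have "finite (set_pmf U)" by (simp add: U_def finite_set_pmf_step)
  then have E: "expect (law [True, False] (spin \<mu>)) f =
      (P ^ 4 + Q ^ 4) * f 1 + 2 * P\<^sup>2 * Q\<^sup>2 * f (- 1) + ((P + Q) ^ 4 - (P\<^sup>2 + Q\<^sup>2)\<^sup>2) * f 0" for f
    by (simp add: U_def[symmetric] expect_step U combine_def)
       (simp add: algebra_simps power2_eq_square power4_eq_xxxx)
  have coeff: "P ^ 4 + Q ^ 4 = (1 + \<mu>\<^sup>2)\<^sup>2 / 4 - (1 - \<mu>\<^sup>2)\<^sup>2 / 8" "2 * P\<^sup>2 * Q\<^sup>2 = (1 - \<mu>\<^sup>2)\<^sup>2 / 8"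
    "P + Q = 1" "P\<^sup>2 + Q\<^sup>2 = (1 + \<mu>\<^sup>2) / 2"
    by (simp_all add: P_def Q_def field_simps power2_eq_square power4_eq_xxxx)
  show ?thesis
    unfolding E coeff mgf_swapped_def by (simp add: field_simps power2_eq_square)
qed

text \<open>Any constant strictly between \<open>1\<close> and \<open>2\<close> could replace
  \<open>3 / 2\<close>: below \<open>2\<close> because of the expansion
  \<open>1 - 2 d\<^sup>2\<close>, above \<open>1\<close> to beat the claimed bound.\<close>

lemma mgf_swapped_le: "eventually (\<lambda>d. mgf_swapped d \<le> exp (- (3 / 2 * d\<^sup>2))) (at_right 0)"
  unfolding mgf_swapped_def by real_asymp

text \<open>A word with \<open>k < r\<close> products is dominated by a repetition code of mean
  \<open>\<mu> = e ^ 2 ^ k\<close>, where \<open>\<mu>\<^sup>2 \<ge> d\<close>, so its exponent is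
  linear in \<open>d\<close>. An unsorted word with \<open>r\<close> products is dominated by the
  word with one inversion, whose transform is \<open>mgf_swapped\<close>.\<close>

lemma expect_err_other_words:
  assumes e: "0 < e" "e \<le> 1" and r: "1 \<le> r"
    and w: "count_list w True = Suc l" "count_list w False \<le> r"
    and ne: "w \<noteq> replicate r False @ replicate (Suc l) True"
  defines "d \<equiv> e ^ 2 ^ r"
  shows "expect (law w (spin e)) err \<le> exp (- (d / 4)) ^ 2 ^ Suc l \<or>
         expect (law w (spin e)) err \<le> mgf_swapped d ^ 2 ^ l"
proof (cases "count_list w False = r")
  case False
  define k where "k = count_list w False"
  define \<mu> where "\<mu> = e ^ 2 ^ k"
  have \<mu>: "0 \<le> \<mu>" "\<mu> \<le> 1" using e by (auto simp: \<mu>_def power_le_one)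
  have "convex_le (law w (spin e)) (law (replicate k False @ replicate (Suc l) True) (spin e))"
    using convex_le_sorted[of "spin e" w] w by (simp add: k_def)
  then have "convex_le (law w (spin e)) (law (replicate (Suc l) True) (spin \<mu>))"
    unfolding law_append using e by (simp add: law_False_spin \<mu>_def)
  then have "expect (law w (spin e)) err \<le> expect (spin \<mu>) (\<lambda>x. exp (- (\<mu> / 2 * x))) ^ 2 ^ Suc l"
    using \<mu> by (intro expect_err_le) (auto simp: finite_set_pmf_law)
  also have "\<dots> \<le> exp (- (\<mu>\<^sup>2 / 4)) ^ 2 ^ Suc l"
    by (intro power_mono expect_exp_spin_le \<mu> integral_nonneg_AE) auto
  also have "\<dots> \<le> exp (- (d / 4)) ^ 2 ^ Suc l"
  proof -
    have "Suc k \<le> r" using False w(2) by (simp add: k_def)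
    then have "(2::nat) ^ Suc k \<le> 2 ^ r" by (intro power_increasing) auto
    then have "e ^ 2 ^ r \<le> e ^ 2 ^ Suc k" by (rule power_decreasing) (use e in auto)
    then have "d \<le> \<mu>\<^sup>2" by (simp add: d_def \<mu>_def power_mult[symmetric] mult.commute)
    then show ?thesis by (intro power_mono) auto
  qed
  finally show ?thesis ..
next
  case True
  then obtain k where k: "r = Suc k" using r by (cases r) auto
  define \<mu> where "\<mu> = e ^ 2 ^ k"
  have \<mu>: "0 \<le> \<mu>" "\<mu> \<le> 1" using e by (auto simp: \<mu>_def power_le_one)
  have d: "d = \<mu>\<^sup>2" by (simp add: d_def \<mu>_def k power_mult[symmetric] mult.commute)
  have "convex_le (law w (spin e)) (law (replicate k False @ [True, False] @ replicate l True) (spin e))"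
    using True w ne by (intro convex_le_almost_sorted) (auto simp: k)
  then have "convex_le (law w (spin e)) (law (replicate l True) (law [True, False] (spin \<mu>)))"
    unfolding law_append using e by (simp add: law_False_spin \<mu>_def)
  then have "expect (law w (spin e)) err \<le>
      expect (law [True, False] (spin \<mu>)) (\<lambda>x. exp (- (4 * \<mu>\<^sup>2 * x))) ^ 2 ^ l"
    by (intro expect_err_le) (auto simp: finite_set_pmf_law finite_set_pmf_step)
  then show ?thesis unfolding expect_exp_swapped[OF \<mu>] d by (rule disjI2)
qed

text \<open>The mean of a symbol after \<open>r\<close> products, that is
  \<open>eps_r r m ^ 2 ^ r\<close>, in closed form.\<close>

definition delta :: "nat \<Rightarrow> nat \<Rightarrow> real" where
  "delta r m = sqrt (2 powr (real r - real m) * (2 * real r * ln (real m)))"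

lemma eps_r_power:
  assumes "r \<ge> 1" "m \<ge> 2"
  shows "eps_r r m > 0" "eps_r r m ^ 2 ^ r = delta r m"
proof -
  define x where "x = 2 powr (real r - real m) * (2 * real r * ln (real m))"
  have x: "x > 0" using assms by (simp add: x_def)
  have eps: "eps_r r m = x powr (1 / 2 ^ (r + 1))"
    by (simp add: eps_r_def x_def mult.assoc)
  show "eps_r r m > 0" using x by (simp add: eps)
  have "eps_r r m ^ 2 ^ r = (x powr (1 / 2 ^ (r + 1))) powr real (2 ^ r)"
    unfolding eps using x by (subst powr_realpow) auto
  also have "\<dots> = x powr (1 / 2)" by (simp add: powr_powr)
  also have "\<dots> = sqrt x" using x by (simp add: powr_half_sqrt)
  finally show "eps_r r m ^ 2 ^ r = delta r m" by (simp add: delta_def x_def)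
qed

text \<open>Here \<open>2 ^ l\<close> is half the number of averaged signs. This normalisation is
  what \<open>eps_r\<close> is chosen for: it produces the power \<open>m ^ - r\<close> of the
  bound.\<close>

lemma delta_squared:
  assumes "r \<ge> 1" "m \<ge> 1" "m = r + Suc l"
  shows "2 ^ l * (delta r m)\<^sup>2 = real r * ln (real m)"
proof -
  have "(delta r m)\<^sup>2 = 2 powr (real r - real m) * (2 * real r * ln (real m))"
    using assms by (simp add: delta_def)
  also have "2 powr (real r - real m) = 1 / 2 ^ Suc l"
  proof -
    have "real r - real m = - real (Suc l)" using assms(3) by simp
    then show ?thesis by (simp only: powr_minus_divide powr_realpow zero_less_numeral)
  qed
  finally show ?thesis by simp
qed

lemma filterlim_delta:
  assumes "r \<ge> 1"
  shows "filterlim (delta r) (at_right 0) sequentially"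
proof -
  define a where "a = real r"
  have "a > 0" using assms by (simp add: a_def)
  then have "filterlim (\<lambda>m::nat. sqrt (2 powr (a - real m) * (2 * a * ln (real m)))) (at_right 0) sequentially"
    by real_asymp
  then show ?thesis by (simp add: delta_def[abs_def] a_def)
qed

section \<open>Terms negligible against the claimed bound\<close>

lemma bound_r_exp:
  assumes "m \<ge> 1"
  shows "bound_r r m = exp (- (real r * ln (real m))) / sqrt (4 * pi * (real r * ln (real m)))"
  using assms by (simp add: bound_r_def powr_def mult.assoc)

lemma bound_r_pos:
  assumes "r \<ge> 1" "m \<ge> 2"
  shows "bound_r r m > 0"
  using assms by (simp add: bound_r_def)

text \<open>The exponent is linear in \<open>delta\<close>, hence of order
  \<open>2 ^ ((m - r) / 2)\<close> up to logarithms, and outruns every multiple of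
  \<open>ln m\<close>.\<close>

lemma eventually_exp_delta_le_bound_r:
  assumes "r \<ge> 1"
  shows "eventually (\<lambda>m. exp (- (delta r m / 4)) ^ 2 ^ (m - r) \<le> bound_r r m) sequentially"
proof -
  define a where "a = real r"
  have "a > 0" using assms by (simp add: a_def)
  \<comment> \<open>Any factor above \<open>1\<close> would do in place of the outer
    \<open>2\<close> on the right; the excess absorbs the square root of \<open>ln m\<close> in
    \<open>bound_r\<close>.\<close>
  then have "eventually (\<lambda>m::nat. - (2 powr (real m - a) * (sqrt (2 powr (a - real m) * (2 * a * ln (real m))) / 4)) \<le>
     - (2 * (a * ln (real m)))) sequentially"
    by real_asymp
  moreover have "eventually (\<lambda>m::nat. exp (- (2 * (a * ln (real m)))) \<le> exp (- (a * ln (real m))) / sqrt (4 * pi * (a * ln (real m)))) sequentially"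
    using \<open>a > 0\<close> by real_asymp
  ultimately show ?thesis
    using eventually_ge_at_top[of "r + 1"]
  proof eventually_elim
    case (elim m)
    have "exp (- (delta r m / 4)) ^ 2 ^ (m - r) = exp (- (2 ^ (m - r) * (delta r m / 4)))"
      by (simp add: exp_of_nat_mult[symmetric])
    also have "2 ^ (m - r) = 2 powr (real m - a)"
      using elim by (simp add: a_def powr_realpow[symmetric] of_nat_diff)
    also have "exp (- (2 powr (real m - a) * (delta r m / 4))) \<le> exp (- (2 * (a * ln (real m))))"
      using elim by (simp add: delta_def a_def)
    also have "\<dots> \<le> bound_r r m"
      using elim by (simp add: bound_r_exp a_def)
    finally show ?case .
  qed
qed

text \<open>By the normalisation of \<open>delta\<close> the left side is at most \<open>m\<close>
  to the power \<open>- 3 r / 2\<close>, smaller than the bound by a power of \<open>m\<close> up to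
  logarithms.\<close>

lemma eventually_mgf_swapped_le_bound_r:
  assumes "r \<ge> 1"
  shows "eventually (\<lambda>m. mgf_swapped (delta r m) ^ 2 ^ (m - Suc r) \<le> bound_r r m) sequentially"
proof -
  define a where "a = real r"
  have "a > 0" using assms by (simp add: a_def)
  have "eventually (\<lambda>m. mgf_swapped (delta r m) \<le> exp (- (3 / 2 * (delta r m)\<^sup>2))) sequentially"
    using mgf_swapped_le filterlim_delta[OF assms] by (rule eventually_compose_filterlim)
  moreover have "eventually (\<lambda>d. mgf_swapped d \<ge> 0) (at_right 0)"
    unfolding mgf_swapped_def by real_asymp
  then have "eventually (\<lambda>m. mgf_swapped (delta r m) \<ge> 0) sequentially"
    using filterlim_delta[OF assms] by (rule eventually_compose_filterlim)
  moreover have "eventually (\<lambda>m::nat. exp (- (3 / 2 * (a * ln (real m)))) \<le> exp (- (a * ln (real m))) / sqrt (4 * pi * (a * ln (real m)))) sequentially"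
    using \<open>a > 0\<close> by real_asymp
  ultimately show ?thesis
    using eventually_ge_at_top[of "r + 1"]
  proof eventually_elim
    case (elim m)
    then obtain l where m: "m = r + Suc l" by (metis add_Suc_right add.commute le_Suc_ex plus_1_eq_Suc)
    have "mgf_swapped (delta r m) ^ 2 ^ l \<le> exp (- (3 / 2 * (delta r m)\<^sup>2)) ^ 2 ^ l"
      using elim by (intro power_mono)
    also have "\<dots> = exp (- (3 / 2 * (2 ^ l * (delta r m)\<^sup>2)))"
      by (simp add: exp_of_nat_mult[symmetric])
    also have "\<dots> = exp (- (3 / 2 * (real r * ln (real m))))"
      using delta_squared[of r m l] assms m by simp
    also have "\<dots> \<le> bound_r r m"
      using elim by (simp add: bound_r_exp a_def)
    finally show ?case by (simp add: m)
  qed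
qed

text \<open>Both follow from \<open>- x - 2 x\<^sup>2 \<le> ln (1 - x) \<le> - x\<close>, multiplied
  by \<open>M\<close>.\<close>

lemma power_one_minus_exp_bounds:
  fixes x :: real
  assumes "0 \<le> x" "x \<le> 1 / 2"
  shows "(1 - x) ^ M * exp (real M * x) \<le> 1"
    and "(1 - x) ^ M * exp (real M * x) \<ge> exp (- (2 * (real M * x) * x))"
proof -
  have eq: "(1 - x) ^ M * exp (real M * x) = exp (real M * (ln (1 - x) + x))"
    using assms by (simp add: distrib_left exp_add exp_of_nat_mult)
  have "ln (1 - x) \<le> - x" using ln_add_one_self_le_self2[of "- x"] assms by simp
  then show "(1 - x) ^ M * exp (real M * x) \<le> 1"
    unfolding eq by (simp add: mult_nonneg_nonpos)
  have "ln (1 - x) + x \<ge> - (2 * x * x)"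
    using ln_one_minus_pos_lower_bound[OF assms] by (simp add: power2_eq_square)
  then have "real M * (ln (1 - x) + x) \<ge> real M * - (2 * x * x)"
    by (rule mult_left_mono) simp
  then show "(1 - x) ^ M * exp (real M * x) \<ge> exp (- (2 * (real M * x) * x))"
    unfolding eq by (simp add: mult_ac)
qed

text \<open>The ratio lies between \<open>G m * c (M m) * (1 - 6 / L m)\<close> and
  \<open>G m * c (M m)\<close>. Here \<open>G\<close> compares a power with an exponential,
  \<open>c\<close> tends to \<open>1\<close> by Wallis, and \<open>L m\<close> tends to
  infinity.\<close>

lemma star_ratio_tendsto:
  assumes r: "r \<ge> 1"
  shows "(\<lambda>m. expect (law (replicate (m - r) True) (spin (delta r m))) err / bound_r r m) \<longlonglongrightarrow> 1"
proof -
  define p where "p m = expect (law (replicate (m - r) True) (spin (delta r m))) err" for m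
  define M where "M m = (2::nat) ^ (m - Suc r)" for m
  define c where "c n = real (2 * n choose n) / 4 ^ n * sqrt (pi * real n)" for n
  define L where "L m = real r * ln (real m)" for m :: nat
  define G where "G m = (1 - (delta r m)\<^sup>2) ^ M m * exp (L m)" for m
  have "filterlim (\<lambda>m. m - Suc r) at_top sequentially"
    by (rule filterlim_minus_const_nat_at_top)
  moreover have "filterlim (\<lambda>k. (2::nat) ^ k) at_top sequentially"
    by (rule filterlim_subseq) (simp add: strict_mono_def)
  ultimately have "filterlim M at_top sequentially"
    unfolding M_def by (rule filterlim_compose[rotated])
  then have clim: "(\<lambda>m. c (M m)) \<longlonglongrightarrow> 1"
    using central_binomial_tendsto unfolding c_def by (rule filterlim_compose[rotated])
  have dlim: "filterlim (delta r) (at_right 0) sequentially"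
    by (rule filterlim_delta[OF r])
  have "eventually (\<lambda>x::real. 0 < x \<and> x < 1 / 2) (at_right 0)"
    unfolding eventually_at_right_field by (intro exI[of _ "1 / 2"]) auto
  then have dsmall: "eventually (\<lambda>m. 0 < delta r m \<and> delta r m < 1 / 2) sequentially"
    using dlim by (rule eventually_compose_filterlim)
  have scale: "eventually (\<lambda>m. real (M m) * (delta r m)\<^sup>2 = L m \<and> (2::nat) ^ (m - r) = 2 * M m \<and> m \<ge> 2) sequentially"
    using eventually_ge_at_top[of "r + 1"]
  proof eventually_elim
    case (elim m)
    then obtain l where m: "m = r + Suc l" by (metis add_Suc_right add.commute le_Suc_ex plus_1_eq_Suc)
    show ?case using delta_squared[of r m l] r m by (auto simp: M_def L_def)
  qed
  define a where "a = real r"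
  have a: "a > 0" using r by (simp add: a_def)
  have Llim: "(\<lambda>m. 1 - 6 / L m) \<longlonglongrightarrow> 1"
    unfolding L_def a_def[symmetric] using a by real_asymp
  \<comment> \<open>\<open>L m\<close> is a multiple of \<open>ln m\<close>, while the square of
    \<open>delta\<close> decays geometrically up to a logarithm, so the exponent vanishes in the
    limit.\<close>
  have "(\<lambda>m::nat. exp (- (2 * (a * ln (real m)) * (2 powr (a - real m) * (2 * a * ln (real m)))))) \<longlonglongrightarrow> 1"
    using a by real_asymp
  moreover have "eventually (\<lambda>m. exp (- (2 * (a * ln (real m)) * (2 powr (a - real m) * (2 * a * ln (real m))))) =
      exp (- (2 * L m * (delta r m)\<^sup>2))) sequentially"
    using eventually_ge_at_top[of 2] by eventually_elim (simp add: delta_def L_def a_def)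
  ultimately have lowlim: "(\<lambda>m. exp (- (2 * L m * (delta r m)\<^sup>2))) \<longlonglongrightarrow> 1"
    by (rule Lim_transform_eventually)
  have sq: "x\<^sup>2 \<le> 1 / 2" if "0 < x \<and> x < 1 / 2" for x :: real
    using that mult_mono[of x "1 / 2" x 1] by (simp add: power2_eq_square)
  have Gbounds: "eventually (\<lambda>m. G m \<le> 1 \<and> G m \<ge> exp (- (2 * L m * (delta r m)\<^sup>2))) sequentially"
    using dsmall scale
  proof eventually_elim
    case (elim m)
    then show ?case
      using power_one_minus_exp_bounds[of "(delta r m)\<^sup>2" "M m"] sq[of "delta r m"] by (simp add: G_def)
  qed
  have Glim: "G \<longlonglongrightarrow> 1"
  proof (rule tendsto_sandwich[OF _ _ lowlim tendsto_const])
    show "eventually (\<lambda>m. exp (- (2 * L m * (delta r m)\<^sup>2)) \<le> G m) sequentially"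
      using Gbounds by eventually_elim simp
    show "eventually (\<lambda>m. G m \<le> 1) sequentially"
      using Gbounds by eventually_elim simp
  qed
  have bounds: "eventually (\<lambda>m. p m / bound_r r m \<le> G m * c (M m) \<and>
      p m / bound_r r m \<ge> G m * c (M m) * (1 - 6 / L m)) sequentially"
    using dsmall scale
  proof eventually_elim
    case (elim m)
    define d where "d = delta r m"
    have d: "0 < d" "d < 1" using elim by (auto simp: d_def)
    have L: "L m = real (M m) * d\<^sup>2" using elim by (simp add: d_def)
    have "sqrt (4 * pi * L m) = sqrt (pi * real (M m)) * sqrt ((2 * d)\<^sup>2)"
      unfolding L real_sqrt_mult[symmetric] by (simp add: power_mult_distrib mult_ac)
    also have "sqrt ((2 * d)\<^sup>2) = 2 * d" using d by (simp only: real_sqrt_abs)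
    finally have b: "bound_r r m = exp (- L m) / (sqrt (pi * real (M m)) * (2 * d))"
      using elim d by (simp add: bound_r_exp L_def)
    have bpos: "bound_r r m > 0" using bound_r_pos[OF r] elim by simp
    \<comment> \<open>The main term of the two-sided estimate; its quotient by
      \<open>bound_r\<close> is \<open>G m * c (M m)\<close> exactly.\<close>
    define X where "X = (1 - d\<^sup>2) ^ M m * (real (2 * M m choose M m) / 4 ^ M m) / (2 * d)"
    have X: "X / bound_r r m = G m * c (M m)"
      using d by (simp add: b X_def G_def c_def d_def exp_minus field_simps)
    have n: "2 ^ (m - r) = 2 * M m" using elim by simp
    have "p m \<le> X"
      using expect_err_spin_bounds(1)[OF d n] unfolding p_def d_def[symmetric] X_def .
    moreover have "p m \<ge> X * (1 - 6 / L m)"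
      using expect_err_spin_bounds(2)[OF d n] unfolding p_def d_def[symmetric] X_def L .
    ultimately have "p m / bound_r r m \<le> X / bound_r r m" "p m / bound_r r m \<ge> X * (1 - 6 / L m) / bound_r r m"
      using bpos by (auto intro: divide_right_mono)
    then show ?case unfolding X[symmetric] by simp
  qed
  show ?thesis
    unfolding p_def[symmetric]
  proof (rule tendsto_sandwich)
    show "eventually (\<lambda>m. G m * c (M m) * (1 - 6 / L m) \<le> p m / bound_r r m) sequentially"
      using bounds by eventually_elim simp
    show "eventually (\<lambda>m. p m / bound_r r m \<le> G m * c (M m)) sequentially"
      using bounds by eventually_elim simp
    show "(\<lambda>m. G m * c (M m) * (1 - 6 / L m)) \<longlonglongrightarrow> 1"
      using tendsto_mult[OF tendsto_mult[OF Glim clim] Llim] by simp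
    show "(\<lambda>m. G m * c (M m)) \<longlonglongrightarrow> 1"
      using tendsto_mult[OF Glim clim] by simp
  qed
qed

theorem theorem3:
  fixes r :: nat
  assumes "r \<ge> 1"
  shows "(\<exists>g :: nat \<Rightarrow> real. g \<longlonglongrightarrow> 0 \<and>
            (\<forall>\<^sub>F m in at_top.
               Max ((\<lambda>xi. perr r m (eps_r r m) xi) ` Gamma r m) \<le> (1 + g m) * bound_r r m))
       \<and> (\<lambda>m. perr r m (eps_r r m) (xi_star r m)) \<sim>[at_top] (\<lambda>m. bound_r r m)"
proof -
  define ps where "ps m = expect (law (replicate (m - r) True) (spin (delta r m))) err" for m
  \<comment> \<open>The absolute value makes \<open>1 + g m \<ge> 1\<close>, so the factor also
    covers the paths whose error probability is at most \<open>bound_r r m\<close>.\<close>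
  define g where "g m = \<bar>ps m / bound_r r m - 1\<bar>" for m
  have ratio: "(\<lambda>m. ps m / bound_r r m) \<longlonglongrightarrow> 1"
    unfolding ps_def by (rule star_ratio_tendsto[OF assms])
  have glim: "g \<longlonglongrightarrow> 0"
    using tendsto_rabs[OF tendsto_diff[OF ratio tendsto_const[of 1]]] by (simp add: g_def[abs_def])
  have "eventually (\<lambda>x::real. x \<le> 1) (at_right 0)"
    by (auto simp: eventually_at_right_field intro!: exI[of _ 1])
  then have "eventually (\<lambda>m. delta r m \<le> 1) sequentially"
    using filterlim_delta[OF assms] by (rule eventually_compose_filterlim)
  then have eps: "eventually (\<lambda>m. r < m \<and> 0 < eps_r r m \<and> eps_r r m \<le> 1 \<and>
      eps_r r m ^ 2 ^ r = delta r m \<and> bound_r r m > 0) sequentially"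
    using eventually_ge_at_top[of "r + 1"]
  proof eventually_elim
    case (elim m)
    then have m: "m \<ge> 2" using assms by simp
    \<comment> \<open>A value above \<open>1\<close> would have its power \<open>delta r m\<close>
      above \<open>1\<close> as well.\<close>
    have "eps_r r m \<le> 1"
    proof (rule ccontr)
      assume "\<not> eps_r r m \<le> 1"
      then have "1 < eps_r r m ^ 2 ^ r" by (intro one_less_power) auto
      then show False using elim eps_r_power[OF assms m] by simp
    qed
    then show ?case using elim eps_r_power[OF assms m] bound_r_pos[OF assms m] by simp
  qed
  have sorted: "expect (law (replicate r False @ replicate (m - r) True) (spin (eps_r r m))) err = ps m"
    if "0 < eps_r r m" "eps_r r m \<le> 1" "eps_r r m ^ 2 ^ r = delta r m" for m
    using that by (simp add: law_append law_False_spin ps_def)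
  have star: "eventually (\<lambda>m. ps m = perr r m (eps_r r m) (xi_star r m)) sequentially"
    using eps
  proof eventually_elim
    case (elim m)
    then show ?case by (simp add: perr_expectation stat_xi_star sorted del: integral_map_pmf)
  qed
  have ps_le: "ps m \<le> (1 + g m) * bound_r r m" if "bound_r r m > 0" for m
  proof -
    have "ps m / bound_r r m \<le> 1 + g m" by (simp add: g_def)
    then show ?thesis using that by (simp add: pos_divide_le_eq)
  qed
  have "eventually (\<lambda>m. Max ((\<lambda>xi. perr r m (eps_r r m) xi) ` Gamma r m) \<le> (1 + g m) * bound_r r m) sequentially"
    using eps eventually_exp_delta_le_bound_r[OF assms] eventually_mgf_swapped_le_bound_r[OF assms]
  proof eventually_elim
    case (elim m)
    let ?e = "eps_r r m"
    have le: "bound_r r m \<le> (1 + g m) * bound_r r m"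
      using elim by (simp add: g_def)
    have "perr r m ?e xi \<le> (1 + g m) * bound_r r m" if "xi \<in> Gamma r m" for xi
    proof -
      have xi: "length xi = m" using that by (simp add: Gamma_def)
      obtain w where w: "count_list w True = m - r" "count_list w False \<le> r"
          "\<And>p. map_pmf (stat r xi) (replicate_pmf (2 ^ m) p) = law w p"
        using map_stat_replicate_pmf[of r xi] xi elim by force
      have perr: "perr r m ?e xi = expect (law w (spin ?e)) err"
        using elim by (simp add: perr_expectation w(3) del: integral_map_pmf)
      show ?thesis
      \<comment> \<open>For the sorted word the error probability is exactly \<open>ps m\<close>;
        for any other word one of the two negligible bounds applies.\<close>
      proof (cases "w = replicate r False @ replicate (m - r) True")
        case True
        then show ?thesis using elim by (simp add: perr sorted ps_le)
      next
        case False
        have m: "m - r = Suc (m - Suc r)" using elim by (simp add: Suc_diff_Suc)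
        have "expect (law w (spin ?e)) err \<le> exp (- (delta r m / 4)) ^ 2 ^ (m - r) \<or>
              expect (law w (spin ?e)) err \<le> mgf_swapped (delta r m) ^ 2 ^ (m - Suc r)"
          using expect_err_other_words[of ?e r w "m - Suc r"] w(1,2) False elim assms m by simp
        then show ?thesis using elim le unfolding perr by linarith
      qed
    qed
    moreover have "finite (Gamma r m)"
      unfolding Gamma_def using finite_lists_length_eq[of "UNIV :: bool set" m] by simp
    \<comment> \<open>A witness that the maximum is over a nonempty set.\<close>
    moreover have "replicate m True \<in> Gamma r m"
      by (simp add: Gamma_def)
    ultimately show ?case
      by (intro Max.boundedI) auto
  qed
  moreover have "(\<lambda>m. perr r m (eps_r r m) (xi_star r m)) \<sim>[at_top] (\<lambda>m. bound_r r m)"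
  proof (rule asymp_equivI')
    show "(\<lambda>m. perr r m (eps_r r m) (xi_star r m) / bound_r r m) \<longlonglongrightarrow> 1"
      using ratio by (rule Lim_transform_eventually) (use star in eventually_elim, simp)
  qed
  ultimately show ?thesis using glim by blast
qed

end
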